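(* Let $\mathcal D$ be a distinguisher in the following game. Phase 1: $\mathcal D$ outputs descriptions of a function $F_0=F:\{0,1\}^m\to\{0,1\}^n$ and of a randomized algorithm $\mathcal B$ whose output is a set $B\subset\{0,1\}^m\times\{0,1\}^n$ in which each $x\in\{0,1\}^m$ is the first element of at most one tuple. Let $B_1=\{x\mid \exists y:(x,y)\in B\}$ and $\epsilon=\max_{x\in\{0,1\}^m}\Pr_{B\leftarrow\mathcal B}[x\in B_1]$. Phase 2: $\mathcal B$ is run (using fresh randomness $r$) to obtain $B$. Let $F_1=F^{(B)}$. A uniform bit $b$ is chosen and $\mathcal D$ is given quantum access to $F_b$. Phase 3: $\mathcal D$ loses access to $F_b$ and receives the randomness $r$ used to run $\mathcal B$ in phase 2. Then $\mathcal D$ outputs a guess $b'$. For any $\mathcal D$ making $q$ queries in expectation when its oracle is $F_0$, it holds that $$\left|\Pr[\mathcal D\text{ outputs }1\mid b=1]-\Pr[\mathcal D\text{ outputs }1\mid b=0]\right|\le 2q\sqrt{\epsilon}.$$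
   Context: For $F:\{0,1\}^m\to\{0,1\}^n$ and a set $B\subset\{0,1\}^m\times\{0,1\}^n$ in which each $x$ is the first element of at most one tuple, $F^{(B)}(x)=y$ if $(x,y)\in B$, and $F^{(B)}(x)=F(x)$ otherwise. Quantum access to $f:\{0,1\}^m\to\{0,1\}^n$ means access to the unitary $|x\rangle|y\rangle\mapsto|x\rangle|y\oplus f(x)\rangle$. $\mathcal D$ is a (computationally unbounded) quantum algorithm that keeps its internal state between phases; it may perform intermediate measurements and adaptively decide, based on their outcomes, whether to make a further query, so the number of queries it makes in phase 2 is a random variable, and $q$ is its expectation conditioned on $b=0$. If the phase-1 output $(F,\mathcal B)$ is itself random, $\epsilon$ is understood as a fixed number bounding $\max_x\Pr_{B\leftarrow\mathcal B}[x\in B_1]$ for every pair $(F,\mathcal B)$ that $\mathcal D$ may output. *)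

theory Defs
  imports "HOL-Probability.Probability" "HOL-Probability.SPMF"
begin

section \<open>Functions on bit strings and reprogramming\<close>

text \<open>
  The set of bit strings of length \<open>CARD('m)\<close> is the finite type \<open>bool ^ 'm\<close>.
\<close>

definition xor_bits :: "bool ^ 'n \<Rightarrow> bool ^ 'n \<Rightarrow> bool ^ 'n" where
  "xor_bits y z = (\<chi> i. y $ i \<noteq> z $ i)"

definition reprogram :: "('x \<Rightarrow> 'y) \<Rightarrow> ('x \<times> 'y) set \<Rightarrow> 'x \<Rightarrow> 'y" where
  "reprogram F B x = (if \<exists>y. (x, y) \<in> B then THE y. (x, y) \<in> B else F x)"

text \<open>
  A randomized algorithm is given by the distribution of its randomness and by the output it
  computes from that randomness.
\<close>

record ('r, 'a) rand_alg =
  coins :: "'r pmf"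
  alg_output :: "'r \<Rightarrow> 'a"


section \<open>States, oracle queries and measurements\<close>

text \<open>
  The state space is the complex Hilbert space of square-summable amplitude functions on a set of
  basis labels. The label type is arbitrary, so workspaces may have infinite dimension.
\<close>

definition ell2 :: "('a \<Rightarrow> complex) set" where
  "ell2 = {\<psi>. (\<lambda>i. (cmod (\<psi> i))\<^sup>2) summable_on UNIV}"

definition ell2_inner :: "('a \<Rightarrow> complex) \<Rightarrow> ('a \<Rightarrow> complex) \<Rightarrow> complex" where
  "ell2_inner \<phi> \<psi> = (\<Sum>\<^sub>\<infinity>i. cnj (\<phi> i) * \<psi> i)"

definition ell2_norm :: "('a \<Rightarrow> complex) \<Rightarrow> real" where
  "ell2_norm \<psi> = sqrt (\<Sum>\<^sub>\<infinity>i. (cmod (\<psi> i))\<^sup>2)"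

definition unit_state :: "('a \<Rightarrow> complex) \<Rightarrow> bool" where
  "unit_state \<psi> \<longleftrightarrow> \<psi> \<in> ell2 \<and> ell2_norm \<psi> = 1"

text \<open>
  Basis labels are triples of an oracle input, an oracle output register and a workspace label.
  The unitary sends the basis vector with label \<open>(x, y, w)\<close> to the one with label
  \<open>(x, y \<oplus> f x, w)\<close>. As \<open>\<oplus> f x\<close> is an involution, the amplitude of the image at
  \<open>(x, y, w)\<close> is the old amplitude at \<open>(x, y \<oplus> f x, w)\<close>.
\<close>

type_synonym ('m, 'n, 'w) qstate = "(bool ^ 'm) \<times> (bool ^ 'n) \<times> 'w \<Rightarrow> complex"

definition query :: "(bool ^ 'm \<Rightarrow> bool ^ 'n) \<Rightarrow>
    ('m::finite, 'n::finite, 'w) qstate \<Rightarrow> ('m, 'n, 'w) qstate" where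
  "query f \<psi> = (\<lambda>(x, y, w). \<psi> (x, xor_bits y (f x), w))"

text \<open>
  General measurements with outcomes in \<open>'o\<close>, given by measurement operators \<open>M a\<close>. The last
  condition is the completeness relation \<open>(\<Sum>a. (M a)\<^sup>\<dagger> (M a)) = 1\<close> in matrix elements.
  A unitary is a measurement whose operators vanish for all outcomes but one.
\<close>

definition linear_operator :: "(('a \<Rightarrow> complex) \<Rightarrow> ('a \<Rightarrow> complex)) \<Rightarrow> bool" where
  "linear_operator A \<longleftrightarrow>
     (\<forall>\<phi>\<in>ell2. A \<phi> \<in> ell2) \<and>
     (\<forall>\<phi>\<in>ell2. \<forall>\<psi>\<in>ell2. A (\<lambda>i. \<phi> i + \<psi> i) = (\<lambda>i. A \<phi> i + A \<psi> i)) \<and>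
     (\<forall>c. \<forall>\<phi>\<in>ell2. A (\<lambda>i. c * \<phi> i) = (\<lambda>i. c * A \<phi> i))"

definition measurement :: "('o \<Rightarrow> ('a \<Rightarrow> complex) \<Rightarrow> ('a \<Rightarrow> complex)) \<Rightarrow> bool" where
  "measurement M \<longleftrightarrow>
     (\<forall>a. linear_operator (M a)) \<and>
     (\<forall>\<phi>\<in>ell2. \<forall>\<psi>\<in>ell2.
        ((\<lambda>a. ell2_inner (M a \<phi>) (M a \<psi>)) has_sum ell2_inner \<phi> \<psi>) UNIV)"

definition outcome :: "('o \<Rightarrow> ('a \<Rightarrow> complex) \<Rightarrow> ('a \<Rightarrow> complex)) \<Rightarrow> ('a \<Rightarrow> complex) \<Rightarrow> 'o pmf" where
  "outcome M \<psi> = embed_pmf (\<lambda>a. (ell2_norm (M a \<psi>))\<^sup>2)"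

definition post_state ::
    "('o \<Rightarrow> ('a \<Rightarrow> complex) \<Rightarrow> ('a \<Rightarrow> complex)) \<Rightarrow> 'o \<Rightarrow> ('a \<Rightarrow> complex) \<Rightarrow> ('a \<Rightarrow> complex)" where
  "post_state M a \<psi> = (\<lambda>i. M a \<psi> i / of_real (ell2_norm (M a \<psi>)))"


section \<open>Distinguishers and the game\<close>

text \<open>
  A distinguisher keeps a quantum state and the list of all measurement outcomes so far, on which
  all its later actions may depend; an algorithm that forgets outcomes is one that ignores them.

  In phase 1 it measures its initial state; the outcome determines \<open>F\<close> and the algorithm that
  samples \<open>B\<close>. In phase 2 the outcomes so far determine whether it makes another query, and after
  each query it performs a measurement. All local computation between two queries, including any
  sequence of unitaries and intermediate measurements, is composed into that one measurement; the
  computation before the first query is part of the measurement in phase 1. In phase 3 it performs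
  a measurement depending on \<open>r\<close>, whose outcome determines the guess.
\<close>

record ('o, 'r, 'm, 'n, 'w) distinguisher =
  init_state :: "('m::finite, 'n::finite, 'w) qstate"
  meas1 :: "'o \<Rightarrow> ('m, 'n, 'w) qstate \<Rightarrow> ('m, 'n, 'w) qstate"
  phase1_output :: "'o \<Rightarrow> (bool ^ 'm \<Rightarrow> bool ^ 'n) \<times> ('r, ((bool ^ 'm) \<times> (bool ^ 'n)) set) rand_alg"
  wants_query :: "'o list \<Rightarrow> bool"
  meas2 :: "'o list \<Rightarrow> 'o \<Rightarrow> ('m, 'n, 'w) qstate \<Rightarrow> ('m, 'n, 'w) qstate"
  meas3 :: "'o list \<Rightarrow> 'r \<Rightarrow> 'o \<Rightarrow> ('m, 'n, 'w) qstate \<Rightarrow> ('m, 'n, 'w) qstate"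
  guess :: "'o list \<Rightarrow> 'r \<Rightarrow> 'o \<Rightarrow> bool"

text \<open>The pairs consisting of a function and a randomized algorithm that may be output in phase 1.\<close>

definition phase1_outputs :: "('o, 'r, 'm::finite, 'n::finite, 'w) distinguisher \<Rightarrow>
    ((bool ^ 'm \<Rightarrow> bool ^ 'n) \<times> ('r, ((bool ^ 'm) \<times> (bool ^ 'n)) set) rand_alg) set" where
  "phase1_outputs D = phase1_output D ` set_pmf (outcome (meas1 D) (init_state D))"

definition valid_distinguisher ::
    "('o, 'r, 'm::finite, 'n::finite, 'w) distinguisher \<Rightarrow> bool" where
  "valid_distinguisher D \<longleftrightarrow>
     unit_state (init_state D) \<and>
     measurement (meas1 D) \<and>
     (\<forall>h. measurement (meas2 D h)) \<and>
     (\<forall>h r. measurement (meas3 D h r)) \<and>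
     (\<forall>(F, \<B>) \<in> phase1_outputs D. \<forall>r \<in> set_pmf (coins \<B>). single_valued (alg_output \<B> r))"

text \<open>
  The arguments are the oracle, the outcomes so far, the current state and the number of queries
  made so far; the last three are returned. The missing probability mass of the resulting
  subprobability distribution is the probability that the queries never end.
\<close>

partial_function (spmf) phase2 ::
    "('o, 'r, 'm::finite, 'n::finite, 'w) distinguisher \<Rightarrow> (bool ^ 'm \<Rightarrow> bool ^ 'n) \<Rightarrow>
     'o list \<Rightarrow> ('m, 'n, 'w) qstate \<Rightarrow> nat \<Rightarrow> ('o list \<times> ('m, 'n, 'w) qstate \<times> nat) spmf" where
  "phase2 D f h \<psi> k =
     (if wants_query D h then
        bind_spmf (spmf_of_pmf (outcome (meas2 D h) (query f \<psi>)))
          (\<lambda>a. phase2 D f (h @ [a]) (post_state (meas2 D h) a (query f \<psi>)) (k + 1))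
      else return_spmf (h, \<psi>, k))"

definition phase3 :: "('o, 'r, 'm::finite, 'n::finite, 'w) distinguisher \<Rightarrow>
    'r \<Rightarrow> 'o list \<Rightarrow> ('m, 'n, 'w) qstate \<Rightarrow> bool pmf" where
  "phase3 D r h \<psi> = map_pmf (guess D h r) (outcome (meas3 D h r) \<psi>)"

text \<open>
  The result consists of the bit \<open>b\<close> and, if the distinguisher halts, its guess and the number of
  queries it made.
\<close>

definition game ::
    "('o, 'r, 'm::finite, 'n::finite, 'w) distinguisher \<Rightarrow> (bool \<times> (bool \<times> nat) option) pmf" where
  "game D =
     do {
       a \<leftarrow> outcome (meas1 D) (init_state D);
       let F = fst (phase1_output D a);
       let \<B> = snd (phase1_output D a);
       r \<leftarrow> coins \<B>;
       let B = alg_output \<B> r;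
       b \<leftarrow> bernoulli_pmf (1/2);
       res \<leftarrow> phase2 D (if b then reprogram F B else F)
                [a] (post_state (meas1 D) a (init_state D)) 0;
       case res of
         None \<Rightarrow> return_pmf (b, None)
       | Some (h, \<psi>, k) \<Rightarrow> do {
           b' \<leftarrow> phase3 D r h \<psi>;
           return_pmf (b, Some (b', k))
         }
     }"

definition outputs_one :: "bool \<times> (bool \<times> nat) option \<Rightarrow> bool" where
  "outputs_one \<omega> \<longleftrightarrow> (\<exists>k. snd \<omega> = Some (True, k))"

definition num_queries :: "bool \<times> (bool \<times> nat) option \<Rightarrow> ennreal" where
  "num_queries \<omega> = (case snd \<omega> of None \<Rightarrow> \<infinity> | Some (b', k) \<Rightarrow> of_nat k)"

definition expected_queries0 :: "('o, 'r, 'm::finite, 'n::finite, 'w) distinguisher \<Rightarrow> ennreal" where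
  "expected_queries0 D = (\<integral>\<^sup>+\<omega>. num_queries \<omega> \<partial>measure_pmf (cond_pmf (game D) {\<omega>. \<not> fst \<omega>}))"

definition max_reprogram_prob ::
    "('r, ('x::finite \<times> 'y) set) rand_alg \<Rightarrow> real" where
  "max_reprogram_prob \<B> = (MAX x. measure_pmf.prob (coins \<B>) {r. x \<in> Domain (alg_output \<B> r)})"

end

theory Submission
  imports Defs
begin

text \<open>
  For a fixed continuation of the distinguisher, the probability of accepting is a quadratic form
  \<open>W\<close> in the unnormalised state with \<open>0 \<le> W \<le> \<parallel>\<cdot>\<parallel>\<^sup>2\<close>, so for vectors \<open>u\<close>, \<open>v\<close> of equal norm
  \<open>\<bar>W u - W v\<bar> \<le> \<parallel>u\<parallel> \<parallel>u - v\<parallel>\<close>. Replace the answers of \<open>F\<^sub>1\<close> by those of \<open>F\<^sub>0\<close> one query at a time. On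
  a history with unnormalised state \<open>u\<close> the two answers differ by at most \<open>2 \<parallel>P u\<parallel>\<close>, where \<open>P\<close> projects
  onto the inputs in \<open>B\<^sub>1\<close>, and the average of \<open>\<parallel>P u\<parallel>\<^sup>2\<close> over \<open>r\<close> is at most \<open>\<epsilon> \<parallel>u\<parallel>\<^sup>2\<close>, as \<open>u\<close> does
  not depend on \<open>r\<close>. The history thus costs at most \<open>2 \<parallel>u\<parallel>\<^sup>2 \<surd>\<epsilon>\<close>, and the sum of \<open>\<parallel>u\<parallel>\<^sup>2\<close> over all
  histories that end in a query to \<open>F\<^sub>0\<close> is the expected number of queries. Square roots are avoided by
  using \<open>2 \<parallel>u\<parallel> \<parallel>P u\<parallel> \<le> \<tau> \<parallel>u\<parallel>\<^sup>2 + \<parallel>P u\<parallel>\<^sup>2 / \<tau>\<close> with \<open>\<tau> = \<surd>\<epsilon>\<close>. Only runs with fewer than \<open>n\<close> queries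
  are compared before \<open>n\<close> tends to infinity, because the runs with \<open>b = 1\<close> need not terminate.
\<close>

section \<open>Squared norms\<close>

text \<open>Values in \<open>ennreal\<close> let sums over labels, outcomes and coins be exchanged
  without summability conditions. The value is infinite exactly outside \<open>ell2\<close>.\<close>

definition sqn :: "('a \<Rightarrow> complex) \<Rightarrow> ennreal" where
  "sqn \<psi> = (\<integral>\<^sup>+i. ennreal ((cmod (\<psi> i))\<^sup>2) \<partial>count_space UNIV)"

lemma nn_integral_count_space_has_sum:
  fixes f :: "'a \<Rightarrow> real"
  assumes "(f has_sum s) A" and "\<And>x. x \<in> A \<Longrightarrow> f x \<ge> 0"
  shows "(\<integral>\<^sup>+x. ennreal (f x) \<partial>count_space A) = ennreal s"
proof -
  have "f summable_on A"
    using assms(1) by (auto simp: summable_on_def)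
  then have abs: "Infinite_Set_Sum.abs_summable_on f A"
    by (rule trans[OF summable_on_iff_abs_summable_on_real abs_summable_equivalent, THEN iffD1])
  have "infsetsum f A = s"
    using infsetsum_infsum[OF abs] assms(1) by (simp add: infsumI)
  then show ?thesis
    using nn_integral_conv_infsetsum[OF abs assms(2)] by simp
qed

lemma ell2_iff_sqn: "\<psi> \<in> ell2 \<longleftrightarrow> sqn \<psi> < \<top>"
proof
  assume "\<psi> \<in> ell2"
  then have "((\<lambda>i. (cmod (\<psi> i))\<^sup>2) has_sum (\<Sum>\<^sub>\<infinity>i. (cmod (\<psi> i))\<^sup>2)) UNIV"
    by (simp add: ell2_def)
  from nn_integral_count_space_has_sum[OF this] show "sqn \<psi> < \<top>"
    by (simp add: sqn_def)
next
  assume "sqn \<psi> < \<top>"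
  then have "integrable (count_space UNIV) (\<lambda>i. (cmod (\<psi> i))\<^sup>2)"
    by (intro integrableI_bounded) (auto simp: sqn_def)
  then have "Infinite_Set_Sum.abs_summable_on (\<lambda>i. (cmod (\<psi> i))\<^sup>2) UNIV"
    by (simp add: Infinite_Set_Sum.abs_summable_on_def)
  then show "\<psi> \<in> ell2"
    unfolding ell2_def mem_Collect_eq
    by (rule trans[OF summable_on_iff_abs_summable_on_real abs_summable_equivalent, THEN iffD2])
qed

lemma sqn_eq_ell2_norm:
  assumes "\<psi> \<in> ell2"
  shows "sqn \<psi> = ennreal ((ell2_norm \<psi>)\<^sup>2)"
proof -
  have "((\<lambda>i. (cmod (\<psi> i))\<^sup>2) has_sum (\<Sum>\<^sub>\<infinity>i. (cmod (\<psi> i))\<^sup>2)) UNIV"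
    using assms by (simp add: ell2_def)
  from nn_integral_count_space_has_sum[OF this] show ?thesis
    by (simp add: sqn_def ell2_norm_def infsum_nonneg)
qed

lemma sqn_scale: "sqn (\<lambda>i. c * \<psi> i) = ennreal ((cmod c)\<^sup>2) * sqn \<psi>"
  by (simp add: sqn_def norm_mult power_mult_distrib ennreal_mult nn_integral_cmult)

lemma ell2_scale: "\<psi> \<in> ell2 \<Longrightarrow> (\<lambda>i. c * \<psi> i) \<in> ell2"
  by (simp add: ell2_iff_sqn sqn_scale ennreal_mult_less_top)

lemma cmod_parallelogram:
  "(cmod (a + b))\<^sup>2 + (cmod (a - b))\<^sup>2 = 2 * (cmod a)\<^sup>2 + 2 * (cmod b)\<^sup>2"
  by (simp add: cmod_power2 power2_sum power2_diff)

lemma sqn_parallelogram: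
  "sqn (\<lambda>i. u i + v i) + sqn (\<lambda>i. u i - v i) = 2 * sqn u + 2 * sqn v"
proof -
  have "sqn (\<lambda>i. u i + v i) + sqn (\<lambda>i. u i - v i) =
      (\<integral>\<^sup>+i. ennreal ((cmod (u i + v i))\<^sup>2 + (cmod (u i - v i))\<^sup>2) \<partial>count_space UNIV)"
    by (simp add: sqn_def nn_integral_add)
  also have "\<dots> = (\<integral>\<^sup>+i. 2 * ennreal ((cmod (u i))\<^sup>2) + 2 * ennreal ((cmod (v i))\<^sup>2) \<partial>count_space UNIV)"
    by (simp add: cmod_parallelogram ennreal_mult'')
  finally show ?thesis
    by (simp add: sqn_def nn_integral_add nn_integral_cmult)
qed

text \<open>In the parallelogram identity a finite right-hand side makes both terms on the left
  finite at once.\<close>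

lemma ell2_add: "u \<in> ell2 \<Longrightarrow> v \<in> ell2 \<Longrightarrow> (\<lambda>i. u i + v i) \<in> ell2"
  and ell2_diff: "u \<in> ell2 \<Longrightarrow> v \<in> ell2 \<Longrightarrow> (\<lambda>i. u i - v i) \<in> ell2"
proof -
  assume "u \<in> ell2" "v \<in> ell2"
  then have "sqn (\<lambda>i. u i + v i) + sqn (\<lambda>i. u i - v i) < \<top>"
    by (auto simp: ell2_iff_sqn sqn_parallelogram ennreal_mult_less_top)
  then show "(\<lambda>i. u i + v i) \<in> ell2" "(\<lambda>i. u i - v i) \<in> ell2"
    by (auto simp: ell2_iff_sqn)
qed

lemma linear_operator_ell2: "linear_operator A \<Longrightarrow> u \<in> ell2 \<Longrightarrow> A u \<in> ell2"
  by (simp add: linear_operator_def)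

lemma linear_operator_scale:
  "linear_operator A \<Longrightarrow> u \<in> ell2 \<Longrightarrow> A (\<lambda>i. c * u i) = (\<lambda>i. c * A u i)"
  by (simp add: linear_operator_def)

lemma linear_operator_add:
  "linear_operator A \<Longrightarrow> u \<in> ell2 \<Longrightarrow> v \<in> ell2 \<Longrightarrow> A (\<lambda>i. u i + v i) = (\<lambda>i. A u i + A v i)"
  by (simp add: linear_operator_def)

lemma linear_operator_diff:
  assumes "linear_operator A" "u \<in> ell2" "v \<in> ell2"
  shows "A (\<lambda>i. u i - v i) = (\<lambda>i. A u i - A v i)"
  using linear_operator_add[OF assms(1,2) ell2_scale[OF assms(3), of "-1"]]
    linear_operator_scale[OF assms(1,3), of "-1"] by simp

lemma measurement_linear: "measurement M \<Longrightarrow> linear_operator (M a)"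
  by (simp add: measurement_def)

text \<open>This is the completeness relation on the diagonal: the unnormalised outcome
  probabilities add up to the squared norm.\<close>

lemma sqn_measurement:
  assumes "measurement M" "u \<in> ell2"
  shows "(\<integral>\<^sup>+a. sqn (M a u) \<partial>count_space UNIV) = sqn u"
proof -
  have inner: "ell2_inner \<psi> \<psi> = of_real ((ell2_norm \<psi>)\<^sup>2)" if "\<psi> \<in> ell2" for \<psi> :: "'b \<Rightarrow> complex"
  proof -
    have "cnj (\<psi> i) * \<psi> i = of_real ((cmod (\<psi> i))\<^sup>2)" for i
      by (simp add: complex_norm_square mult.commute del: of_real_power)
    moreover have "((\<lambda>i. (cmod (\<psi> i))\<^sup>2) has_sum (ell2_norm \<psi>)\<^sup>2) UNIV"
      using that by (simp add: ell2_def ell2_norm_def infsum_nonneg)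
    ultimately show ?thesis
      unfolding ell2_inner_def by (simp only: infsumI[OF has_sum_of_real])
  qed
  have lin: "linear_operator (M a)" for a
    using assms(1) by (rule measurement_linear)
  have "((\<lambda>a. ell2_inner (M a u) (M a u)) has_sum ell2_inner u u) UNIV"
    using assms by (simp add: measurement_def)
  then have "((\<lambda>a. complex_of_real ((ell2_norm (M a u))\<^sup>2)) has_sum of_real ((ell2_norm u)\<^sup>2)) UNIV"
    using assms(2) by (simp add: inner linear_operator_ell2[OF lin] del: of_real_power)
  then have "((\<lambda>a. (ell2_norm (M a u))\<^sup>2) has_sum (ell2_norm u)\<^sup>2) UNIV"
    by (simp only: has_sum_of_real_iff)
  from nn_integral_count_space_has_sum[OF this] show ?thesis
    using assms(2) by (simp add: sqn_eq_ell2_norm linear_operator_ell2[OF lin])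
qed

section \<open>Quadratic forms bounded by the squared norm\<close>

text \<open>
  For a quadratic form, \<open>W (x + y) - W (x - y)\<close> is four times the real part of the associated
  sesquilinear form at \<open>(x, y)\<close>, hence unchanged under \<open>(x, y) \<mapsto> (t x, y / t)\<close>. This consequence,
  written without subtraction, suffices for the bound on \<open>W u - W v\<close>, and it
  survives sums and composition with linear operators.
\<close>

definition effect :: "(('a \<Rightarrow> complex) \<Rightarrow> ennreal) \<Rightarrow> bool" where
  "effect W \<longleftrightarrow> (\<forall>u\<in>ell2. W u \<le> sqn u) \<and>
     (\<forall>x\<in>ell2. \<forall>y\<in>ell2. \<forall>t::real. t > 0 \<longrightarrow>
        W (\<lambda>i. x i + y i) + W (\<lambda>i. of_real t * x i - of_real (1 / t) * y i) =
        W (\<lambda>i. x i - y i) + W (\<lambda>i. of_real t * x i + of_real (1 / t) * y i))"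

lemma effect_le: "effect W \<Longrightarrow> u \<in> ell2 \<Longrightarrow> W u \<le> sqn u"
  by (simp add: effect_def)

lemma effect_rescale:
  "effect W \<Longrightarrow> x \<in> ell2 \<Longrightarrow> y \<in> ell2 \<Longrightarrow> t > 0 \<Longrightarrow>
    W (\<lambda>i. x i + y i) + W (\<lambda>i. of_real t * x i - of_real (1 / t) * y i) =
    W (\<lambda>i. x i - y i) + W (\<lambda>i. of_real t * x i + of_real (1 / t) * y i)"
  unfolding effect_def by blast

lemma effect_zero: "effect (\<lambda>_. 0)"
  by (simp add: effect_def)

text \<open>The vectors \<open>t x\<close> and \<open>y / t\<close> have the same cross term as
  \<open>x\<close> and \<open>y\<close>. On either side of the identity the two cross terms cancel,
  which leaves the same four squares.\<close>

lemma effect_sqn: "effect sqn"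
  unfolding effect_def
proof (intro conjI ballI allI impI order_refl)
  fix x y :: "'a \<Rightarrow> complex" and t :: real
  assume "t > 0"
  have "(cmod (a + b))\<^sup>2 + (cmod (of_real t * a - of_real (1 / t) * b))\<^sup>2 =
      (cmod (a - b))\<^sup>2 + (cmod (of_real t * a + of_real (1 / t) * b))\<^sup>2" for a b
    using \<open>t > 0\<close> by (simp add: cmod_power2 power2_sum power2_diff)
  then show "sqn (\<lambda>i. x i + y i) + sqn (\<lambda>i. of_real t * x i - of_real (1 / t) * y i) =
      sqn (\<lambda>i. x i - y i) + sqn (\<lambda>i. of_real t * x i + of_real (1 / t) * y i)"
    unfolding sqn_def
    by (subst (1 2) nn_integral_add[symmetric]) (simp_all flip: ennreal_plus)
qed

lemma effect_compose:
  assumes "effect W" and lin: "linear_operator A" and "\<And>u. u \<in> ell2 \<Longrightarrow> sqn (A u) \<le> sqn u"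
  shows "effect (\<lambda>u. W (A u))"
  unfolding effect_def
proof (intro conjI ballI allI impI)
  fix u :: "'a \<Rightarrow> complex" assume "u \<in> ell2"
  then show "W (A u) \<le> sqn u"
    using effect_le[OF assms(1) linear_operator_ell2[OF lin]] assms(3) order_trans by blast
next
  fix x y :: "'a \<Rightarrow> complex" and t :: real
  assume xy: "x \<in> ell2" "y \<in> ell2" and t: "t > 0"
  show "W (A (\<lambda>i. x i + y i)) + W (A (\<lambda>i. of_real t * x i - of_real (1 / t) * y i)) =
      W (A (\<lambda>i. x i - y i)) + W (A (\<lambda>i. of_real t * x i + of_real (1 / t) * y i))"
    using effect_rescale[OF assms(1) linear_operator_ell2[OF lin xy(1)]
        linear_operator_ell2[OF lin xy(2)] t] xy
    by (simp only: linear_operator_add[OF lin] linear_operator_diff[OF lin]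
        linear_operator_scale[OF lin] ell2_scale)
qed

text \<open>The upper bound is inherited because the squared norms of the branches add up to that of
  \<open>u\<close>; the identity is summed over the outcomes.\<close>

lemma effect_instrument:
  assumes W: "\<And>a. effect (W a)" and M: "measurement M"
  shows "effect (\<lambda>u. \<integral>\<^sup>+a. W a (M a u) \<partial>count_space UNIV)"
  unfolding effect_def
proof (intro conjI ballI allI impI)
  fix u :: "'b \<Rightarrow> complex" assume u: "u \<in> ell2"
  have "(\<integral>\<^sup>+a. W a (M a u) \<partial>count_space UNIV) \<le> (\<integral>\<^sup>+a. sqn (M a u) \<partial>count_space UNIV)"
    using u by (intro nn_integral_mono effect_le[OF W]
        linear_operator_ell2[OF measurement_linear[OF M]])
  then show "(\<integral>\<^sup>+a. W a (M a u) \<partial>count_space UNIV) \<le> sqn u"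
    by (simp add: sqn_measurement[OF M u])
next
  fix x y :: "'b \<Rightarrow> complex" and t :: real
  assume xy: "x \<in> ell2" "y \<in> ell2" and t: "t > 0"
  have lin: "linear_operator (M a)" for a
    using M by (rule measurement_linear)
  show "(\<integral>\<^sup>+a. W a (M a (\<lambda>i. x i + y i)) \<partial>count_space UNIV) +
      (\<integral>\<^sup>+a. W a (M a (\<lambda>i. of_real t * x i - of_real (1 / t) * y i)) \<partial>count_space UNIV) =
      (\<integral>\<^sup>+a. W a (M a (\<lambda>i. x i - y i)) \<partial>count_space UNIV) +
      (\<integral>\<^sup>+a. W a (M a (\<lambda>i. of_real t * x i + of_real (1 / t) * y i)) \<partial>count_space UNIV)"
    using effect_rescale[OF W linear_operator_ell2[OF lin xy(1)]
        linear_operator_ell2[OF lin xy(2)] t] xy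
    by (subst (1 2) nn_integral_add[symmetric])
      (simp_all only: linear_operator_add[OF lin] linear_operator_diff[OF lin]
        linear_operator_scale[OF lin] ell2_scale, simp_all)
qed

text \<open>
  With \<open>x = (u + v) / 2\<close> and \<open>y = (u - v) / 2\<close> the defining equation gives
  \<open>W u \<le> W v + W (t x + y / t) \<le> W v + \<parallel>t x + y / t\<parallel>\<^sup>2\<close>, and the cross term of the last norm vanishes
  because \<open>\<parallel>u\<parallel> = \<parallel>v\<parallel>\<close>.
\<close>

lemma effect_le_perturb:
  assumes W: "effect W" and uv: "u \<in> ell2" "v \<in> ell2" and eq: "sqn u = sqn v" and "\<tau> > 0"
  shows "W u \<le> W v + (ennreal \<tau> * sqn u + ennreal (1 / \<tau>) * sqn (\<lambda>i. (u i - v i) / 2))"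
proof -
  define t where "t = sqrt \<tau>"
  have t: "t > 0" "t\<^sup>2 = \<tau>" using \<open>\<tau> > 0\<close> by (simp_all add: t_def)
  define x where "x = (\<lambda>i. (u i + v i) / 2)"
  define y where "y = (\<lambda>i. (u i - v i) / 2)"
  define z where "z = (\<lambda>i. of_real t * x i + of_real (1 / t) * y i)"
  define z' where "z' = (\<lambda>i. of_real t * x i - of_real (1 / t) * y i)"
  have xy: "x \<in> ell2" "y \<in> ell2"
    using ell2_scale[OF ell2_add[OF uv], of "1/2"] ell2_scale[OF ell2_diff[OF uv], of "1/2"]
    by (simp_all add: x_def y_def)
  have u: "(\<lambda>i. x i + y i) = u" and v: "(\<lambda>i. x i - y i) = v"
    by (auto simp: x_def y_def field_simps)
  have "z \<in> ell2"
    unfolding z_def by (intro ell2_add ell2_scale xy)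
  have "sqn u + sqn z' = sqn v + sqn z"
    using effect_rescale[OF effect_sqn xy t(1)] by (simp only: u v z_def z'_def)
  \<comment> \<open>The equal norms of \<open>u\<close> and \<open>v\<close> may be cancelled
    because they are finite. With \<open>z\<close> and \<open>z'\<close> of equal norm, the
    parallelogram identity determines \<open>sqn z\<close>.\<close>
  then have "sqn z' = sqn z"
    using uv by (auto simp: eq ell2_iff_sqn ennreal_add_left_cancel)
  then have "sqn z + sqn z = 2 * sqn (\<lambda>i. of_real t * x i) + 2 * sqn (\<lambda>i. of_real (1 / t) * y i)"
    using sqn_parallelogram[of "\<lambda>i. of_real t * x i" "\<lambda>i. of_real (1 / t) * y i"]
    by (simp add: z_def z'_def)
  moreover have "sqn (\<lambda>i. of_real t * x i) = ennreal \<tau> * sqn x"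
    by (subst sqn_scale) (simp add: t)
  moreover have "sqn (\<lambda>i. of_real (1 / t) * y i) = ennreal (1 / \<tau>) * sqn y"
    by (subst sqn_scale, subst norm_of_real) (simp add: t power_divide)
  ultimately have "2 * sqn z = 2 * (ennreal \<tau> * sqn x + ennreal (1 / \<tau>) * sqn y)"
    by (simp only: distrib_left mult_2)
  then have z: "sqn z = ennreal \<tau> * sqn x + ennreal (1 / \<tau>) * sqn y"
    by (subst (asm) ennreal_mult_cancel_left) simp
  have "2 * sqn x \<le> 2 * sqn x + 2 * sqn y" by simp
  also have "\<dots> = 2 * sqn u"
    using sqn_parallelogram[of x y] by (simp add: u v eq mult_2)
  finally have "sqn x \<le> sqn u"
    by (simp add: ennreal_mult_le_mult_iff)
  have "W u \<le> W u + W z'" by simp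
  also have "\<dots> = W v + W z"
    using effect_rescale[OF W xy t(1)] by (simp only: u v z_def z'_def)
  also have "W z \<le> sqn z"
    using W \<open>z \<in> ell2\<close> by (rule effect_le)
  also have "sqn z \<le> ennreal \<tau> * sqn u + ennreal (1 / \<tau>) * sqn y"
    unfolding z using \<open>sqn x \<le> sqn u\<close> by (intro add_mono mult_left_mono) auto
  finally show ?thesis by (simp add: y_def add_mono)
qed

section \<open>Queries to two oracles\<close>

text \<open>The map is its own inverse, as adding \<open>f x\<close> twice restores
  \<open>y\<close>.\<close>

lemma bij_xor_bits: "bij (\<lambda>(x, y, w). (x, xor_bits y (f x), w))"
  by (rule o_bij[of "\<lambda>(x, y, w). (x, xor_bits y (f x), w)"])
    (auto simp: xor_bits_def vec_eq_iff fun_eq_iff)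

lemma sqn_query: "sqn (query f u) = sqn u"
  using nn_integral_bij_count_space[OF bij_xor_bits, where f = "\<lambda>i. ennreal ((cmod (u i))\<^sup>2)", of f]
  by (simp add: sqn_def query_def case_prod_unfold)

lemma ell2_query: "u \<in> ell2 \<Longrightarrow> query f u \<in> ell2"
  by (simp add: ell2_iff_sqn sqn_query)

lemma linear_operator_query: "linear_operator (query f)"
  by (auto simp: linear_operator_def ell2_query) (auto simp: query_def)

definition restrict_inputs :: "'x set \<Rightarrow> ('x \<times> 'z \<Rightarrow> complex) \<Rightarrow> 'x \<times> 'z \<Rightarrow> complex" where
  "restrict_inputs S u = (\<lambda>i. if fst i \<in> S then u i else 0)"

text \<open>A query keeps the input register, so the two answers differ only on the projected part.
  Both images of that part have its norm, so their difference has at most twice that norm; the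
  halving matches \<open>effect_le_perturb\<close>.\<close>

lemma sqn_query_diff:
  assumes "\<And>x. x \<notin> S \<Longrightarrow> f x = g x"
  shows "sqn (\<lambda>i. (query f u i - query g u i) / 2) \<le> sqn (restrict_inputs S u)"
proof -
  let ?p = "query f (restrict_inputs S u)" and ?q = "query g (restrict_inputs S u)"
  have *: "(\<lambda>i. (query f u i - query g u i) / 2) = (\<lambda>i. (1 / 2) * (?p i - ?q i))"
    using assms by (auto simp: query_def restrict_inputs_def fun_eq_iff)
  have "sqn (\<lambda>i. (1 / 2) * (?p i - ?q i)) = ennreal (1 / 4) * sqn (\<lambda>i. ?p i - ?q i)"
    by (subst sqn_scale) (simp add: power2_eq_square)
  also have "\<dots> \<le> ennreal (1 / 4) * (sqn (\<lambda>i. ?p i + ?q i) + sqn (\<lambda>i. ?p i - ?q i))"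
    by (intro mult_left_mono) auto
  also have "\<dots> = ennreal (1 / 4) * (ennreal 4 * sqn (restrict_inputs S u))"
    by (simp only: sqn_parallelogram sqn_query) (simp flip: distrib_right)
  also have "\<dots> = sqn (restrict_inputs S u)"
    by (subst mult.assoc[symmetric], subst ennreal_mult[symmetric]) auto
  finally show ?thesis by (simp only: *)
qed

text \<open>The index type may be uncountable, where counting measure is not sigma-finite. With
  \<open>p\<close> written as a density, both orders become one integral over pairs with respect to
  counting measure.\<close>

lemma nn_integral_pmf_count_space_swap:
  "(\<integral>\<^sup>+r. \<integral>\<^sup>+i. f r i \<partial>count_space UNIV \<partial>measure_pmf p) =
   (\<integral>\<^sup>+i. \<integral>\<^sup>+r. f r i \<partial>measure_pmf p \<partial>count_space UNIV)"
proof -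
  let ?g = "\<lambda>(r, i). ennreal (pmf p r) * f r i"
  have "(\<integral>\<^sup>+r. \<integral>\<^sup>+i. ?g (r, i) \<partial>count_space UNIV \<partial>count_space UNIV) =
      (\<integral>\<^sup>+i. \<integral>\<^sup>+r. ?g (r, i) \<partial>count_space UNIV \<partial>count_space UNIV)"
    unfolding nn_integral_fst_count_space nn_integral_snd_count_space ..
  then show ?thesis
    by (simp add: nn_integral_measure_pmf nn_integral_cmult)
qed

text \<open>Since \<open>u\<close> is fixed before \<open>r\<close> is drawn, each label keeps its
  squared amplitude with the probability that its input lies in \<open>S r\<close>.\<close>

lemma nn_integral_sqn_restrict_inputs_le:
  fixes u :: "'x \<times> 'z \<Rightarrow> complex"
  assumes "\<And>x. measure_pmf.prob p {r. x \<in> S r} \<le> \<epsilon>" "0 \<le> \<epsilon>"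
  shows "(\<integral>\<^sup>+r. sqn (restrict_inputs (S r) u) \<partial>measure_pmf p) \<le> ennreal \<epsilon> * sqn u"
proof -
  have "(\<integral>\<^sup>+r. sqn (restrict_inputs (S r) u) \<partial>measure_pmf p) =
      (\<integral>\<^sup>+i. \<integral>\<^sup>+r. ennreal ((cmod (u i))\<^sup>2) * indicator {r. fst i \<in> S r} r \<partial>measure_pmf p \<partial>count_space UNIV)"
    unfolding sqn_def nn_integral_pmf_count_space_swap
    by (intro nn_integral_cong) (simp add: restrict_inputs_def)
  also have "\<dots> \<le> (\<integral>\<^sup>+i. ennreal \<epsilon> * ennreal ((cmod (u i))\<^sup>2) \<partial>count_space UNIV)"
  proof (rule nn_integral_mono)
    fix i :: "'x \<times> 'z"
    have "emeasure (measure_pmf p) {r. fst i \<in> S r} \<le> ennreal \<epsilon>"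
      using assms by (simp add: measure_pmf.emeasure_eq_measure ennreal_leI)
    then show "(\<integral>\<^sup>+r. ennreal ((cmod (u i))\<^sup>2) * indicator {r. fst i \<in> S r} r \<partial>measure_pmf p)
        \<le> ennreal \<epsilon> * ennreal ((cmod (u i))\<^sup>2)"
      by (simp add: nn_integral_cmult mult.commute[of "ennreal \<epsilon>"] mult_left_mono)
  qed
  also have "\<dots> = ennreal \<epsilon> * sqn u"
    by (simp add: sqn_def nn_integral_cmult)
  finally show ?thesis .
qed

section \<open>The hybrid argument\<close>

lemma valid_measurement2: "valid_distinguisher D \<Longrightarrow> measurement (meas2 D h)"
  and valid_measurement3: "valid_distinguisher D \<Longrightarrow> measurement (meas3 D h r)"
  by (simp_all add: valid_distinguisher_def)

text \<open>
  States are not normalised after a measurement, so their squared norms carry the probabilities of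
  the outcomes. Runs with \<open>n\<close> or more queries do not contribute to \<open>accept D f r n\<close>.
\<close>

primrec accept :: "('o, 'r, 'm::finite, 'n::finite, 'w) distinguisher \<Rightarrow> (bool ^ 'm \<Rightarrow> bool ^ 'n) \<Rightarrow>
    'r \<Rightarrow> nat \<Rightarrow> 'o list \<Rightarrow> ('m, 'n, 'w) qstate \<Rightarrow> ennreal" where
  "accept D f r 0 h u = 0"
| "accept D f r (Suc n) h u =
    (if wants_query D h
     then \<integral>\<^sup>+a. accept D f r n (h @ [a]) (meas2 D h a (query f u)) \<partial>count_space UNIV
     else \<integral>\<^sup>+c. (if guess D h r c then sqn (meas3 D h r c u) else 0) \<partial>count_space UNIV)"

text \<open>Each query contributes the squared norm of the state it acts on, which is the
  probability that it is made. From a unit state the sum is the expectation of the number of queries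
  capped at \<open>n\<close>.\<close>

primrec query_weight :: "('o, 'r, 'm::finite, 'n::finite, 'w) distinguisher \<Rightarrow>
    (bool ^ 'm \<Rightarrow> bool ^ 'n) \<Rightarrow> nat \<Rightarrow> 'o list \<Rightarrow> ('m, 'n, 'w) qstate \<Rightarrow> ennreal" where
  "query_weight D f 0 h u = 0"
| "query_weight D f (Suc n) h u =
    (if wants_query D h
     then sqn u + (\<integral>\<^sup>+a. query_weight D f n (h @ [a]) (meas2 D h a (query f u)) \<partial>count_space UNIV)
     else 0)"

lemma effect_accept:
  assumes "valid_distinguisher D"
  shows "effect (accept D f r n h)"
proof (induction n arbitrary: h)
  case 0
  show ?case by (simp add: effect_zero)
next
  case (Suc n)
  have "effect (\<lambda>u. \<integral>\<^sup>+a. accept D f r n (h @ [a]) (meas2 D h a u) \<partial>count_space UNIV)"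
    using Suc valid_measurement2[OF assms] by (rule effect_instrument)
  then have "effect (\<lambda>u. \<integral>\<^sup>+a. accept D f r n (h @ [a]) (meas2 D h a (query f u)) \<partial>count_space UNIV)"
    by (rule effect_compose) (simp_all add: linear_operator_query sqn_query)
  \<comment> \<open>Rejected outcomes carry the zero form, so that the guess fits
    \<open>effect_instrument\<close>.\<close>
  moreover have "effect (\<lambda>u. \<integral>\<^sup>+c. (if guess D h r c then sqn else (\<lambda>_. 0)) (meas3 D h r c u) \<partial>count_space UNIV)"
    using valid_measurement3[OF assms]
    by (intro effect_instrument[where W = "\<lambda>c. if guess D h r c then sqn else (\<lambda>_. 0)"])
      (simp_all add: effect_sqn effect_zero)
  ultimately show ?case
    by (cases "wants_query D h") (simp_all add: if_distribR cong: if_cong)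
qed

text \<open>The answer to the present query is exchanged first, with all later answers still from
  \<open>G r\<close>; the induction hypothesis then exchanges the later ones. The state reached
  through \<open>F\<close> does not depend on \<open>r\<close>, so the average over \<open>r\<close>
  can be taken at every level. Two inequalities replace an absolute value in
  \<open>ennreal\<close>.\<close>

lemma accept_hybrid:
  fixes D :: "('o, 'r, 'm::finite, 'n::finite, 'w) distinguisher"
  assumes valid: "valid_distinguisher D"
    and agree: "\<And>r x. x \<notin> S r \<Longrightarrow> G r x = F x"
    and prob: "\<And>x. measure_pmf.prob p {r. x \<in> S r} \<le> \<epsilon>"
    and pos: "\<epsilon> > 0"
    and u: "u \<in> ell2"
  shows "(\<integral>\<^sup>+r. accept D (G r) r n h u \<partial>measure_pmf p) \<le>
          (\<integral>\<^sup>+r. accept D F r n h u \<partial>measure_pmf p) + ennreal (2 * sqrt \<epsilon>) * query_weight D F n h u \<and>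
        (\<integral>\<^sup>+r. accept D F r n h u \<partial>measure_pmf p) \<le>
          (\<integral>\<^sup>+r. accept D (G r) r n h u \<partial>measure_pmf p) + ennreal (2 * sqrt \<epsilon>) * query_weight D F n h u"
  using u
proof (induction n arbitrary: h u)
  case 0
  show ?case by simp
next
  case (Suc n)
  let ?c = "ennreal (2 * sqrt \<epsilon>)"
  \<comment> \<open>Both forms act on the state just after the present query: \<open>V\<close>
    answers later queries by \<open>G r\<close>, \<open>V0\<close> by \<open>F\<close>. The price of
    exchanging the present answer is \<open>err\<close>, and \<open>w\<close> is the weight of the
    later queries.\<close>
  define V where "V r v = (\<integral>\<^sup>+a. accept D (G r) r n (h @ [a]) (meas2 D h a v) \<partial>count_space UNIV)" for r v
  define V0 where "V0 r v = (\<integral>\<^sup>+a. accept D F r n (h @ [a]) (meas2 D h a v) \<partial>count_space UNIV)" for r v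
  define err where "err r = ennreal (sqrt \<epsilon>) * sqn u + ennreal (1 / sqrt \<epsilon>) * sqn (restrict_inputs (S r) u)"
    for r
  define w where "w = (\<integral>\<^sup>+a. query_weight D F n (h @ [a]) (meas2 D h a (query F u)) \<partial>count_space UNIV)"
  have M: "meas2 D h a (query F u) \<in> ell2" for a
    using linear_operator_ell2[OF measurement_linear[OF valid_measurement2[OF valid]] ell2_query[OF Suc.prems]] .
  \<comment> \<open>The induction hypothesis is used separately for each outcome \<open>a\<close>,
    after the sum over outcomes has been moved outside the average over \<open>r\<close>.\<close>
  have step: "(\<integral>\<^sup>+r. V r (query F u) \<partial>measure_pmf p) \<le> (\<integral>\<^sup>+r. V0 r (query F u) \<partial>measure_pmf p) + ?c * w"
    "(\<integral>\<^sup>+r. V0 r (query F u) \<partial>measure_pmf p) \<le> (\<integral>\<^sup>+r. V r (query F u) \<partial>measure_pmf p) + ?c * w"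
    unfolding V_def V0_def w_def nn_integral_pmf_count_space_swap
    by (simp_all add: nn_integral_mono Suc.IH[THEN conjunct1] Suc.IH[THEN conjunct2] M flip: nn_integral_cmult nn_integral_add)
  have V: "effect (V r)" for r
    unfolding V_def
    by (intro effect_instrument effect_accept valid valid_measurement2)
  have diff: "sqn (\<lambda>i. (query (G r) u i - query F u i) / 2) \<le> sqn (restrict_inputs (S r) u)"
    "sqn (\<lambda>i. (query F u i - query (G r) u i) / 2) \<le> sqn (restrict_inputs (S r) u)" for r
    by (intro sqn_query_diff; simp add: agree)+
  have swap: "V r (query (G r) u) \<le> V r (query F u) + err r"
    "V r (query F u) \<le> V r (query (G r) u) + err r" for r
  proof -
    show "V r (query (G r) u) \<le> V r (query F u) + err r"
      using effect_le_perturb[OF V ell2_query[OF Suc.prems] ell2_query[OF Suc.prems], of "G r" F "sqrt \<epsilon>" r] pos diff(1)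
      by (auto simp: sqn_query err_def elim!: order_trans intro!: add_mono mult_left_mono)
    show "V r (query F u) \<le> V r (query (G r) u) + err r"
      using effect_le_perturb[OF V ell2_query[OF Suc.prems] ell2_query[OF Suc.prems], of F "G r" "sqrt \<epsilon>" r] pos diff(2)
      by (auto simp: sqn_query err_def elim!: order_trans intro!: add_mono mult_left_mono)
  qed
  \<comment> \<open>For \<tau> = \<open>sqrt \<epsilon>\<close> both summands of \<open>err\<close>
    have an average of at most \<open>sqrt \<epsilon> * sqn u\<close>, which gives the factor
    2.\<close>
  have err: "(\<integral>\<^sup>+r. err r \<partial>measure_pmf p) \<le> ?c * sqn u"
  proof -
    have "(\<integral>\<^sup>+r. err r \<partial>measure_pmf p) \<le>
        ennreal (sqrt \<epsilon>) * sqn u + ennreal (1 / sqrt \<epsilon>) * (ennreal \<epsilon> * sqn u)"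
      unfolding err_def using prob pos
      by (simp add: nn_integral_add nn_integral_cmult mult_left_mono nn_integral_sqn_restrict_inputs_le)
    also have "ennreal (1 / sqrt \<epsilon>) * (ennreal \<epsilon> * sqn u) = ennreal (sqrt \<epsilon>) * sqn u"
      using pos by (simp add: real_div_sqrt flip: ennreal_mult mult.assoc)
    also have "ennreal (sqrt \<epsilon>) * sqn u + ennreal (sqrt \<epsilon>) * sqn u = ?c * sqn u"
      using pos by (simp flip: ennreal_plus distrib_right)
    finally show ?thesis .
  qed
  show ?case
  proof (intro conjI)
    show "(\<integral>\<^sup>+r. accept D (G r) r (Suc n) h u \<partial>measure_pmf p) \<le>
      (\<integral>\<^sup>+r. accept D F r (Suc n) h u \<partial>measure_pmf p) + ?c * query_weight D F (Suc n) h u"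
    proof (cases "wants_query D h")
      case True
      have "(\<integral>\<^sup>+r. V r (query (G r) u) \<partial>measure_pmf p) \<le>
          (\<integral>\<^sup>+r. V r (query F u) \<partial>measure_pmf p) + (\<integral>\<^sup>+r. err r \<partial>measure_pmf p)"
        using swap(1) by (simp add: nn_integral_mono flip: nn_integral_add)
      also have "\<dots> \<le> ((\<integral>\<^sup>+r. V0 r (query F u) \<partial>measure_pmf p) + ?c * w) + ?c * sqn u"
        by (intro add_mono step err)
      finally show ?thesis
        by (simp only: accept.simps query_weight.simps True if_True V_def V0_def w_def distrib_left add_ac)
    qed simp
  next
    show "(\<integral>\<^sup>+r. accept D F r (Suc n) h u \<partial>measure_pmf p) \<le>
      (\<integral>\<^sup>+r. accept D (G r) r (Suc n) h u \<partial>measure_pmf p) + ?c * query_weight D F (Suc n) h u"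
    proof (cases "wants_query D h")
      case True
      have "(\<integral>\<^sup>+r. V0 r (query F u) \<partial>measure_pmf p) \<le> (\<integral>\<^sup>+r. V r (query F u) \<partial>measure_pmf p) + ?c * w"
        by (rule step)
      also have "\<dots> \<le> ((\<integral>\<^sup>+r. V r (query (G r) u) \<partial>measure_pmf p) +
          (\<integral>\<^sup>+r. err r \<partial>measure_pmf p)) + ?c * w"
        using swap(2) by (intro add_right_mono) (simp add: nn_integral_mono flip: nn_integral_add)
      also have "\<dots> \<le> ((\<integral>\<^sup>+r. V r (query (G r) u) \<partial>measure_pmf p) + ?c * sqn u) + ?c * w"
        by (intro add_mono order_refl err)
      finally show ?thesis
        by (simp only: accept.simps query_weight.simps True if_True V_def V0_def w_def distrib_left add_ac)
    qed simp
  qed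
qed

section \<open>Probabilities in the game\<close>

lemma unit_state_iff: "unit_state \<psi> \<longleftrightarrow> \<psi> \<in> ell2 \<and> sqn \<psi> = 1"
proof -
  have "ell2_norm \<psi> \<ge> 0"
    by (simp add: ell2_norm_def infsum_nonneg)
  then show ?thesis
    by (auto simp: unit_state_def sqn_eq_ell2_norm power2_eq_1_iff)
qed

text \<open>By completeness the weights sum to 1 on a unit state, so \<open>embed_pmf\<close>
  returns them unchanged.\<close>

lemma pmf_outcome:
  assumes M: "measurement M" and \<psi>: "unit_state \<psi>"
  shows "ennreal (pmf (outcome M \<psi>) a) = sqn (M a \<psi>)"
proof -
  have \<psi>': "\<psi> \<in> ell2" "sqn \<psi> = 1"
    using \<psi> by (simp_all add: unit_state_iff)
  have eq: "ennreal ((ell2_norm (M a \<psi>))\<^sup>2) = sqn (M a \<psi>)" for a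
    using linear_operator_ell2[OF measurement_linear[OF M] \<psi>'(1)] by (simp add: sqn_eq_ell2_norm)
  have "pmf (outcome M \<psi>) a = (ell2_norm (M a \<psi>))\<^sup>2"
    unfolding outcome_def by (rule pmf_embed_pmf) (simp_all add: eq sqn_measurement[OF M] \<psi>')
  then show ?thesis by (simp add: eq)
qed

lemma nn_integral_outcome:
  assumes "measurement M" "unit_state \<psi>"
  shows "(\<integral>\<^sup>+a. g a \<partial>measure_pmf (outcome M \<psi>)) = (\<integral>\<^sup>+a. sqn (M a \<psi>) * g a \<partial>count_space UNIV)"
  by (simp add: nn_integral_measure_pmf pmf_outcome[OF assms])

text \<open>An outcome in the support has a nonzero branch, so the normalisation does not divide by
  zero.\<close>

lemma unit_post_state:
  assumes M: "measurement M" and \<psi>: "unit_state \<psi>" and a: "a \<in> set_pmf (outcome M \<psi>)"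
  shows "unit_state (post_state M a \<psi>)"
proof -
  have ell2: "M a \<psi> \<in> ell2"
    using linear_operator_ell2[OF measurement_linear[OF M]] \<psi> by (simp add: unit_state_iff)
  have post: "post_state M a \<psi> = (\<lambda>i. of_real (1 / ell2_norm (M a \<psi>)) * M a \<psi> i)"
    by (simp add: post_state_def)
  have "sqn (M a \<psi>) \<noteq> 0"
    using a by (simp add: set_pmf_iff flip: pmf_outcome[OF M \<psi>])
  then have "ell2_norm (M a \<psi>) \<noteq> 0"
    using sqn_eq_ell2_norm[OF ell2] by auto
  then have "sqn (post_state M a \<psi>) = 1"
    unfolding post by (simp only: sqn_scale sqn_eq_ell2_norm[OF ell2] norm_of_real flip: ennreal_mult)
      (simp add: power_divide flip: ennreal_mult)
  moreover have "post_state M a \<psi> \<in> ell2"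
    unfolding post using ell2 by (rule ell2_scale)
  ultimately show ?thesis by (simp add: unit_state_iff)
qed

section \<open>Homogeneity and the passage to unnormalised states\<close>

definition quadratic :: "(('a \<Rightarrow> complex) \<Rightarrow> ennreal) \<Rightarrow> bool" where
  "quadratic K \<longleftrightarrow> (\<forall>u\<in>ell2. \<forall>c. K (\<lambda>i. c * u i) = ennreal ((cmod c)\<^sup>2) * K u)"

lemma quadraticD: "quadratic K \<Longrightarrow> u \<in> ell2 \<Longrightarrow> K (\<lambda>i. c * u i) = ennreal ((cmod c)\<^sup>2) * K u"
  by (simp add: quadratic_def)

lemma quadratic_sqn: "quadratic sqn"
  by (simp add: quadratic_def sqn_scale)

lemma quadratic_zero: "quadratic (\<lambda>_. 0)"
  by (simp add: quadratic_def)

lemma quadratic_add: "quadratic K \<Longrightarrow> quadratic L \<Longrightarrow> quadratic (\<lambda>u. K u + L u)"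
  by (simp add: quadratic_def distrib_left)

lemma quadratic_compose:
  "quadratic K \<Longrightarrow> linear_operator A \<Longrightarrow> quadratic (\<lambda>u. K (A u))"
  by (simp add: quadratic_def linear_operator_scale linear_operator_ell2)

lemma quadratic_nn_integral:
  "(\<And>a. quadratic (K a)) \<Longrightarrow> quadratic (\<lambda>u. \<integral>\<^sup>+a. K a u \<partial>count_space UNIV)"
  by (simp add: quadratic_def nn_integral_cmult)

lemma linear_operator_compose:
  "linear_operator A \<Longrightarrow> linear_operator B \<Longrightarrow> linear_operator (\<lambda>u. A (B u))"
  by (simp add: linear_operator_def)

lemma quadratic_accept:
  assumes "valid_distinguisher D"
  shows "quadratic (accept D f r n h)"
proof (induction n arbitrary: h)
  case 0
  show ?case by (simp add: quadratic_zero)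
next
  case (Suc n)
  have lin: "linear_operator (\<lambda>u. meas2 D h a (query f u))" for a
    by (rule linear_operator_compose[OF measurement_linear[OF valid_measurement2[OF assms]]
          linear_operator_query])
  have "quadratic (\<lambda>u. \<integral>\<^sup>+a. accept D f r n (h @ [a]) (meas2 D h a (query f u)) \<partial>count_space UNIV)"
    by (intro quadratic_nn_integral quadratic_compose[OF Suc] lin)
  moreover have "quadratic (\<lambda>u. \<integral>\<^sup>+c. (if guess D h r c then sqn (meas3 D h r c u) else 0) \<partial>count_space UNIV)"
  proof (rule quadratic_nn_integral)
    fix c
    show "quadratic (\<lambda>u. if guess D h r c then sqn (meas3 D h r c u) else 0)"
      using quadratic_compose[OF quadratic_sqn measurement_linear[OF valid_measurement3[OF assms]]]
      by (cases "guess D h r c") (simp_all add: quadratic_zero)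
  qed
  ultimately show ?case
    by (cases "wants_query D h") simp_all
qed

lemma quadratic_query_weight:
  assumes "valid_distinguisher D"
  shows "quadratic (query_weight D f n h)"
proof (induction n arbitrary: h)
  case 0
  show ?case by (simp add: quadratic_zero)
next
  case (Suc n)
  have lin: "linear_operator (\<lambda>u. meas2 D h a (query f u))" for a
    by (rule linear_operator_compose[OF measurement_linear[OF valid_measurement2[OF assms]]
          linear_operator_query])
  have "quadratic (\<lambda>u. sqn u + (\<integral>\<^sup>+a. query_weight D f n (h @ [a]) (meas2 D h a (query f u)) \<partial>count_space UNIV))"
    by (intro quadratic_add quadratic_sqn quadratic_nn_integral quadratic_compose[OF Suc] lin)
  then show ?case
    by (cases "wants_query D h") (simp_all add: quadratic_zero)
qed

lemma sqn_eq_0_iff: "sqn u = 0 \<longleftrightarrow> u = (\<lambda>_. 0)"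
  by (auto simp: sqn_def nn_integral_0_iff_AE AE_count_space fun_eq_iff)

text \<open>The probability of an outcome is the squared norm that normalisation divides out, so by
  homogeneity the two factors cancel.\<close>

lemma nn_integral_outcome_post_state:
  assumes M: "measurement M" and \<psi>: "unit_state \<psi>" and K: "\<And>a. quadratic (K a)"
  shows "(\<integral>\<^sup>+a. K a (post_state M a \<psi>) \<partial>measure_pmf (outcome M \<psi>)) =
    (\<integral>\<^sup>+a. K a (M a \<psi>) \<partial>count_space UNIV)"
proof -
  have "sqn (M a \<psi>) * K a (post_state M a \<psi>) = K a (M a \<psi>)" for a
  proof -
    have ell2: "M a \<psi> \<in> ell2"
      using linear_operator_ell2[OF measurement_linear[OF M]] \<psi> by (simp add: unit_state_iff)
    show ?thesis
    proof (cases "sqn (M a \<psi>) = 0")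
      \<comment> \<open>An outcome of probability zero leaves the zero vector, where homogeneity
        with factor 0 makes \<open>K a\<close> vanish too.\<close>
      case True
      then have "M a \<psi> = (\<lambda>_. 0)"
        by (simp add: sqn_eq_0_iff)
      then show ?thesis
        using quadraticD[OF K ell2, of a 0] True by simp
    next
      case False
      let ?c = "ell2_norm (M a \<psi>)"
      have "?c \<noteq> 0"
        using False sqn_eq_ell2_norm[OF ell2] by auto
      then have "sqn (M a \<psi>) * ennreal ((cmod (of_real (1 / ?c)))\<^sup>2) = 1"
        by (simp only: sqn_eq_ell2_norm[OF ell2] norm_of_real flip: ennreal_mult)
          (simp add: power_divide flip: ennreal_mult)
      moreover have "K a (post_state M a \<psi>) = ennreal ((cmod (of_real (1 / ?c)))\<^sup>2) * K a (M a \<psi>)"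
        using quadraticD[OF K ell2, of a "of_real (1 / ?c)"] by (simp add: post_state_def)
      ultimately show ?thesis
        by (simp only: mult.assoc[symmetric] mult_1)
    qed
  qed
  then show ?thesis
    by (simp add: nn_integral_outcome[OF M \<psi>])
qed

lemma unit_query: "unit_state \<psi> \<Longrightarrow> unit_state (query f \<psi>)"
  by (simp add: unit_state_iff ell2_query sqn_query)

section \<open>Phase 2 as a recursion on unnormalised states\<close>

lemma phase2_count_ge:
  assumes "(h', \<phi>, k') \<in> set_spmf (phase2 D f h \<psi> k)"
  shows "k \<le> k'"
proof -
  \<comment> \<open>All arguments are quantified because fixed-point induction treats the whole
    function; a recursive call starts from a larger counter.\<close>
  have "\<forall>D f h \<psi> k. \<forall>y\<in>set_spmf (phase2 D f h \<psi> k). k \<le> snd (snd y)"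
  proof (induction rule: phase2.fixp_induct)
    case 1
    show ?case by simp
  next
    case 2
    show ?case by simp
  next
    case (3 p)
    then show ?case
      by (auto simp: set_spmf_bind_pmf bind_UNION; fastforce)
  qed
  then show ?thesis using assms by fastforce
qed

text \<open>A query raises \<open>k\<close> and lowers the remaining budget \<open>n\<close> by one,
  so the bound \<open>k + n\<close> is preserved. At budget 0 nothing counts, since the counter
  never drops below \<open>k\<close>.\<close>

lemma phase2_accept:
  assumes valid: "valid_distinguisher D" and "unit_state \<psi>"
  shows "(\<integral>\<^sup>+x. (case x of None \<Rightarrow> 0 | Some (h', \<phi>, k') \<Rightarrow>
            if k' < k + n then emeasure (phase3 D r h' \<phi>) {True} else 0) \<partial>measure_pmf (phase2 D f h \<psi> k))
         = accept D f r n h \<psi>" (is "(\<integral>\<^sup>+x. ?g k n x \<partial>_) = _")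
  using assms(2)
proof (induction n arbitrary: h \<psi> k)
  case 0
  have "AE x in measure_pmf (phase2 D f h \<psi> k). ?g k 0 x = 0"
    using phase2_count_ge[of _ _ _ D f h \<psi> k]
    by (auto simp: AE_measure_pmf_iff in_set_spmf split: option.splits) fastforce+
  then show ?case by (simp add: nn_integral_0_iff_AE)
next
  case (Suc n)
  note M2 = valid_measurement2[OF valid] and M3 = valid_measurement3[OF valid]
  show ?case
  proof (cases "wants_query D h")
    case True
    let ?q = "query f \<psi>" and ?M = "meas2 D h"
    have "(\<integral>\<^sup>+x. ?g k (Suc n) x \<partial>measure_pmf (phase2 D f h \<psi> k)) =
        (\<integral>\<^sup>+a. \<integral>\<^sup>+x. ?g (k + 1) n x \<partial>measure_pmf (phase2 D f (h @ [a]) (post_state ?M a ?q) (k + 1))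
           \<partial>measure_pmf (outcome ?M ?q))"
      using True by (subst phase2.simps) simp
    also have "\<dots> = (\<integral>\<^sup>+a. accept D f r n (h @ [a]) (post_state ?M a ?q) \<partial>measure_pmf (outcome ?M ?q))"
      by (intro nn_integral_cong_AE, unfold AE_measure_pmf_iff)
        (intro ballI Suc.IH unit_post_state M2 unit_query Suc.prems)
    also have "\<dots> = (\<integral>\<^sup>+a. accept D f r n (h @ [a]) (?M a ?q) \<partial>count_space UNIV)"
      by (intro nn_integral_outcome_post_state M2 unit_query Suc.prems quadratic_accept valid)
    finally show ?thesis using True by simp
  next
    case False
    have "emeasure (phase3 D r h \<psi>) {True} =
        (\<integral>\<^sup>+c. indicator {c. guess D h r c} c \<partial>measure_pmf (outcome (meas3 D h r) \<psi>))"
      by (simp add: phase3_def vimage_def)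
    also have "\<dots> = (\<integral>\<^sup>+c. (if guess D h r c then sqn (meas3 D h r c \<psi>) else 0) \<partial>count_space UNIV)"
      by (subst nn_integral_outcome[OF M3 Suc.prems]) (auto intro!: nn_integral_cong)
    finally show ?thesis
      using False by (subst phase2.simps) simp
  qed
qed

text \<open>Truncation after \<open>n\<close> steps only loses queries, and runs that never halt
  count as infinite on the right.\<close>

lemma phase2_query_weight:
  assumes valid: "valid_distinguisher D" and "unit_state \<psi>"
  shows "of_nat k + query_weight D f n h \<psi> \<le>
    (\<integral>\<^sup>+x. (case x of None \<Rightarrow> \<infinity> | Some (h', \<phi>, k') \<Rightarrow> of_nat k') \<partial>measure_pmf (phase2 D f h \<psi> k))"
    (is "_ \<le> (\<integral>\<^sup>+x. ?g x \<partial>_)")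
  using assms(2)
proof (induction n arbitrary: h \<psi> k)
  case 0
  have "AE x in measure_pmf (phase2 D f h \<psi> k). of_nat k \<le> ?g x"
    using phase2_count_ge[of _ _ _ D f h \<psi> k]
    by (auto simp: AE_measure_pmf_iff in_set_spmf split: option.splits)
  then have "(\<integral>\<^sup>+x. of_nat k \<partial>measure_pmf (phase2 D f h \<psi> k)) \<le> (\<integral>\<^sup>+x. ?g x \<partial>measure_pmf (phase2 D f h \<psi> k))"
    by (rule nn_integral_mono_AE)
  then show ?case by simp
next
  case (Suc n)
  note M2 = valid_measurement2[OF valid]
  show ?case
  proof (cases "wants_query D h")
    case True
    let ?q = "query f \<psi>" and ?M = "meas2 D h"
    \<comment> \<open>As \<open>sqn \<psi> = 1\<close>, the present query is absorbed into the
      counter.\<close>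
    have "of_nat k + query_weight D f (Suc n) h \<psi> =
        of_nat (k + 1) + (\<integral>\<^sup>+a. query_weight D f n (h @ [a]) (?M a ?q) \<partial>count_space UNIV)"
      using True Suc.prems by (simp add: unit_state_iff add_ac)
    also have "(\<integral>\<^sup>+a. query_weight D f n (h @ [a]) (?M a ?q) \<partial>count_space UNIV) =
        (\<integral>\<^sup>+a. query_weight D f n (h @ [a]) (post_state ?M a ?q) \<partial>measure_pmf (outcome ?M ?q))"
      by (intro nn_integral_outcome_post_state[symmetric] M2 unit_query Suc.prems quadratic_query_weight valid)
    also have "of_nat (k + 1) + \<dots> =
        (\<integral>\<^sup>+a. of_nat (k + 1) + query_weight D f n (h @ [a]) (post_state ?M a ?q) \<partial>measure_pmf (outcome ?M ?q))"
      by (subst nn_integral_add) simp_all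
    also have "\<dots> \<le> (\<integral>\<^sup>+a. \<integral>\<^sup>+x. ?g x \<partial>measure_pmf (phase2 D f (h @ [a]) (post_state ?M a ?q) (k + 1))
           \<partial>measure_pmf (outcome ?M ?q))"
      by (intro nn_integral_mono_AE, unfold AE_measure_pmf_iff)
        (intro ballI Suc.IH unit_post_state M2 unit_query Suc.prems)
    also have "\<dots> = (\<integral>\<^sup>+x. ?g x \<partial>measure_pmf (phase2 D f h \<psi> k))"
      using True by (subst (2) phase2.simps) simp
    finally show ?thesis .
  next
    case False
    then show ?thesis
      by (subst phase2.simps) simp
  qed
qed

section \<open>The game for a fixed bit\<close>

definition branch :: "('o, 'r, 'm::finite, 'n::finite, 'w) distinguisher \<Rightarrow> bool \<Rightarrow> (bool \<times> nat) option pmf" where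
  "branch D b =
     do {
       a \<leftarrow> outcome (meas1 D) (init_state D);
       r \<leftarrow> coins (snd (phase1_output D a));
       res \<leftarrow> phase2 D
                (if b then reprogram (fst (phase1_output D a)) (alg_output (snd (phase1_output D a)) r)
                 else fst (phase1_output D a))
                [a] (post_state (meas1 D) a (init_state D)) 0;
       case res of
         None \<Rightarrow> return_pmf None
       | Some (h, \<psi>, k) \<Rightarrow> map_pmf (\<lambda>b'. Some (b', k)) (phase3 D r h \<psi>)
     }"

text \<open>The bit is independent of phase 1 and of \<open>r\<close>, so it may be drawn
  first.\<close>

lemma game_eq_branch: "game D = bind_pmf (bernoulli_pmf (1/2)) (\<lambda>b. map_pmf (Pair b) (branch D b))"
proof -
  have commute: "bind_pmf P (\<lambda>b. bind_pmf Q (\<lambda>a. bind_pmf (R a) (Y b a))) =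
      bind_pmf Q (\<lambda>a. bind_pmf (R a) (\<lambda>r. bind_pmf P (\<lambda>b. Y b a r)))"
    for P :: "bool pmf" and Q :: "'a pmf" and R :: "'a \<Rightarrow> 'b pmf"
      and Y :: "bool \<Rightarrow> 'a \<Rightarrow> 'b \<Rightarrow> (bool \<times> (bool \<times> nat) option) pmf"
    by (subst bind_commute_pmf) (intro bind_pmf_cong refl bind_commute_pmf)
  show ?thesis
    unfolding game_def branch_def Let_def map_bind_pmf commute
    by (intro bind_pmf_cong refl) (auto simp: map_pmf_def bind_assoc_pmf bind_return_pmf split: option.split)
qed

lemma measure_game:
  "measure_pmf.prob (game D) A =
    (measure_pmf.prob (branch D True) (Pair True -` A) + measure_pmf.prob (branch D False) (Pair False -` A)) / 2"
proof -
  have "emeasure (measure_pmf (game D)) A =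
      emeasure (measure_pmf (branch D True)) (Pair True -` A) * ennreal (1 / 2) +
      emeasure (measure_pmf (branch D False)) (Pair False -` A) * ennreal (1 / 2)"
    by (simp add: game_eq_branch)
  also have "\<dots> = ennreal (measure_pmf.prob (branch D True) (Pair True -` A) * (1 / 2) +
      measure_pmf.prob (branch D False) (Pair False -` A) * (1 / 2))"
    by (simp only: measure_pmf.emeasure_eq_measure ennreal_plus ennreal_mult measure_nonneg
        mult_nonneg_nonneg zero_le_divide_1_iff zero_le_numeral)
  finally show ?thesis
    by (simp add: measure_pmf.emeasure_eq_measure add_divide_distrib del: ennreal_plus)
qed

text \<open>The condition has probability 1/2, which cancels the factor in
  \<open>measure_game\<close>.\<close>

lemma prob_outputs_one_True:
  "\<P>(\<omega> in measure_pmf (game D). outputs_one \<omega> \<bar> fst \<omega>) =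
    measure_pmf.prob (branch D True) {x. \<exists>k. x = Some (True, k)}"
  and prob_outputs_one_False:
  "\<P>(\<omega> in measure_pmf (game D). outputs_one \<omega> \<bar> \<not> fst \<omega>) =
    measure_pmf.prob (branch D False) {x. \<exists>k. x = Some (True, k)}"
  by (simp_all add: cond_prob_def measure_game outputs_one_def vimage_def)

lemma cond_game_False: "cond_pmf (game D) {\<omega>. \<not> fst \<omega>} = map_pmf (Pair False) (branch D False)"
proof -
  have "measure_pmf.prob (game D) {\<omega>. \<not> fst \<omega>} = 1 / 2"
    by (simp add: measure_game vimage_def)
  then have ne: "set_pmf (game D) \<inter> {\<omega>. \<not> fst \<omega>} \<noteq> {}" and
    half: "measure_pmf.prob (game D) {\<omega>. \<not> fst \<omega>} = 1 / 2"
    by (auto simp flip: measure_pmf_zero_iff)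
  show ?thesis
  proof (rule pmf_eqI)
    fix \<omega> :: "bool \<times> (bool \<times> nat) option"
    have "pmf (game D) \<omega> = (measure_pmf.prob (branch D True) (Pair True -` {\<omega>}) +
        measure_pmf.prob (branch D False) (Pair False -` {\<omega>})) / 2"
      by (simp add: measure_game flip: measure_pmf_single)
    moreover have "Pair True -` {\<omega>} = {}" if "\<not> fst \<omega>"
      using that by auto
    moreover have "Pair False -` {\<omega>} = {}" if "fst \<omega>"
      using that by auto
    ultimately show "pmf (cond_pmf (game D) {\<omega>. \<not> fst \<omega>}) \<omega> = pmf (map_pmf (Pair False) (branch D False)) \<omega>"
      by (auto simp: pmf_cond[OF ne] half pmf_map)
  qed
qed

lemma branch_accept:
  assumes valid: "valid_distinguisher D"
  shows "emeasure (measure_pmf (branch D b)) {x. \<exists>k<n. x = Some (True, k)} =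
    (\<integral>\<^sup>+a. \<integral>\<^sup>+r. accept D
        (if b then reprogram (fst (phase1_output D a)) (alg_output (snd (phase1_output D a)) r)
         else fst (phase1_output D a)) r n [a] (post_state (meas1 D) a (init_state D))
      \<partial>measure_pmf (coins (snd (phase1_output D a))) \<partial>measure_pmf (outcome (meas1 D) (init_state D)))"
    (is "_ = (\<integral>\<^sup>+a. \<integral>\<^sup>+r. accept D (?f a r) r n _ (?\<psi> a) \<partial>_ \<partial>_)")
proof -
  let ?A = "{x. \<exists>k<n. x = Some (True, k)}"
  have unit: "unit_state (?\<psi> a)" if "a \<in> set_pmf (outcome (meas1 D) (init_state D))" for a
    using valid that by (intro unit_post_state) (auto simp: valid_distinguisher_def)
  \<comment> \<open>The form \<open>0 + n\<close> matches \<open>phase2_accept\<close> with the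
    counter starting at 0.\<close>
  have phase3: "emeasure (measure_pmf (map_pmf (\<lambda>b'. Some (b', k)) p)) ?A =
      (if k < 0 + n then emeasure (measure_pmf p) {True} else 0)" for k and p :: "bool pmf"
  proof -
    have "(\<lambda>b'. Some (b', k)) -` ?A = (if k < n then {True} else {})" by auto
    then show ?thesis by simp
  qed
  have "emeasure (measure_pmf (case res of None \<Rightarrow> return_pmf None
        | Some (h, \<psi>, k) \<Rightarrow> map_pmf (\<lambda>b'. Some (b', k)) (phase3 D r h \<psi>))) ?A =
      (case res of None \<Rightarrow> 0 | Some (h, \<psi>, k) \<Rightarrow>
        if k < 0 + n then emeasure (phase3 D r h \<psi>) {True} else 0)" for res r
    by (auto split: option.split simp: phase3 simp del: emeasure_map_pmf)
  then have "emeasure (measure_pmf (branch D b)) ?A =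
    (\<integral>\<^sup>+a. \<integral>\<^sup>+r. \<integral>\<^sup>+res. (case res of None \<Rightarrow> 0 | Some (h, \<psi>, k) \<Rightarrow>
        if k < 0 + n then emeasure (phase3 D r h \<psi>) {True} else 0)
      \<partial>measure_pmf (phase2 D (?f a r) [a] (?\<psi> a) 0)
      \<partial>measure_pmf (coins (snd (phase1_output D a))) \<partial>measure_pmf (outcome (meas1 D) (init_state D)))"
    unfolding branch_def by (simp only: emeasure_bind_pmf)
  also have "\<dots> = (\<integral>\<^sup>+a. \<integral>\<^sup>+r. accept D (?f a r) r n [a] (?\<psi> a)
      \<partial>measure_pmf (coins (snd (phase1_output D a))) \<partial>measure_pmf (outcome (meas1 D) (init_state D)))"
    by (intro nn_integral_cong_AE, unfold AE_measure_pmf_iff)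
      (intro ballI nn_integral_cong phase2_accept[OF valid unit])
  finally show ?thesis .
qed

lemma query_weight_le_expected_queries0:
  assumes valid: "valid_distinguisher D"
  shows "(\<integral>\<^sup>+a. query_weight D (fst (phase1_output D a)) n [a] (post_state (meas1 D) a (init_state D))
      \<partial>measure_pmf (outcome (meas1 D) (init_state D))) \<le> expected_queries0 D"
    (is "(\<integral>\<^sup>+a. query_weight D (?F a) n _ (?\<psi> a) \<partial>_) \<le> _")
proof -
  have unit: "unit_state (?\<psi> a)" if "a \<in> set_pmf (outcome (meas1 D) (init_state D))" for a
    using valid that by (intro unit_post_state) (auto simp: valid_distinguisher_def)
  have count: "(\<integral>\<^sup>+x. num_queries (False, x) \<partial>measure_pmf (case res of None \<Rightarrow> return_pmf None
        | Some (h, \<psi>, k) \<Rightarrow> map_pmf (\<lambda>b'. Some (b', k)) (phase3 D r h \<psi>))) =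
      (case res of None \<Rightarrow> \<infinity> | Some (h, \<psi>, k) \<Rightarrow> of_nat k)" for res r
    by (auto simp: num_queries_def split: option.split)
  \<comment> \<open>The run with \<open>F\<close> ignores \<open>r\<close>; the constant average
    over the coins is inserted to match \<open>branch\<close>.\<close>
  have "(\<integral>\<^sup>+a. query_weight D (?F a) n [a] (?\<psi> a) \<partial>measure_pmf (outcome (meas1 D) (init_state D))) =
      (\<integral>\<^sup>+a. \<integral>\<^sup>+r. of_nat 0 + query_weight D (?F a) n [a] (?\<psi> a)
        \<partial>measure_pmf (coins (snd (phase1_output D a))) \<partial>measure_pmf (outcome (meas1 D) (init_state D)))"
    by simp
  also have "\<dots> \<le> (\<integral>\<^sup>+a. \<integral>\<^sup>+r. \<integral>\<^sup>+res. (case res of None \<Rightarrow> \<infinity> | Some (h, \<psi>, k) \<Rightarrow> of_nat k)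
      \<partial>measure_pmf (phase2 D (?F a) [a] (?\<psi> a) 0)
      \<partial>measure_pmf (coins (snd (phase1_output D a))) \<partial>measure_pmf (outcome (meas1 D) (init_state D)))"
    by (intro nn_integral_mono_AE, unfold AE_measure_pmf_iff)
      (intro ballI nn_integral_mono phase2_query_weight[OF valid unit])
  also have "\<dots> = expected_queries0 D"
    unfolding expected_queries0_def cond_game_False branch_def
    by (simp add: count)
  finally show ?thesis .
qed

section \<open>From truncated runs to the full game\<close>

lemma prob_mem_Domain_le_max_reprogram_prob:
  "measure_pmf.prob (coins \<B>) {r. x \<in> Domain (alg_output \<B> r)} \<le> max_reprogram_prob \<B>"
  unfolding max_reprogram_prob_def by (rule Max_ge) auto

text \<open>The outcome \<open>a\<close> of phase 1 fixes \<open>F\<close>, the sampler and the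
  state before the coins are drawn, so \<open>accept_hybrid\<close> applies for each
  \<open>a\<close>. Averaging over \<open>a\<close> bounds the query weights by
  \<open>q\<close>.\<close>

lemma branch_accept_diff:
  assumes valid: "valid_distinguisher D"
    and bound: "\<And>F \<B>. (F, \<B>) \<in> phase1_outputs D \<Longrightarrow> max_reprogram_prob \<B> \<le> \<epsilon>"
    and pos: "\<epsilon> > 0" and q: "0 \<le> q" "expected_queries0 D = ennreal q"
  shows "\<bar>measure_pmf.prob (branch D True) {x. \<exists>k<n. x = Some (True, k)} -
      measure_pmf.prob (branch D False) {x. \<exists>k<n. x = Some (True, k)}\<bar> \<le> 2 * q * sqrt \<epsilon>"
proof -
  let ?A = "{x. \<exists>k<n. x = Some (True, k)}" and ?P = "measure_pmf (outcome (meas1 D) (init_state D))"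
  let ?F = "\<lambda>a. fst (phase1_output D a)" and ?B = "\<lambda>a. snd (phase1_output D a)"
  let ?\<psi> = "\<lambda>a. post_state (meas1 D) a (init_state D)" and ?c = "ennreal (2 * sqrt \<epsilon>)"
  let ?G = "\<lambda>a r. reprogram (?F a) (alg_output (?B a) r)"
  define I0 where "I0 a = (\<integral>\<^sup>+r. accept D (?F a) r n [a] (?\<psi> a) \<partial>measure_pmf (coins (?B a)))" for a
  define I1 where "I1 a = (\<integral>\<^sup>+r. accept D (?G a r) r n [a] (?\<psi> a) \<partial>measure_pmf (coins (?B a)))" for a
  define w where "w a = query_weight D (?F a) n [a] (?\<psi> a)" for a
  have E0: "emeasure (measure_pmf (branch D False)) ?A = (\<integral>\<^sup>+a. I0 a \<partial>?P)"
    and E1: "emeasure (measure_pmf (branch D True)) ?A = (\<integral>\<^sup>+a. I1 a \<partial>?P)"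
    by (simp_all add: branch_accept[OF valid] I0_def I1_def)
  have hybrid: "I1 a \<le> I0 a + ?c * w a \<and> I0 a \<le> I1 a + ?c * w a"
    if a: "a \<in> set_pmf (outcome (meas1 D) (init_state D))" for a
    unfolding I0_def I1_def w_def
  proof (rule accept_hybrid[OF valid, where S = "\<lambda>r. Domain (alg_output (?B a) r)"])
    show "?G a r x = ?F a x" if "x \<notin> Domain (alg_output (?B a) r)" for r x
      using that by (auto simp: reprogram_def)
    have "(?F a, ?B a) \<in> phase1_outputs D"
      using a by (auto simp: phase1_outputs_def)
    then show "measure_pmf.prob (coins (?B a)) {r. x \<in> Domain (alg_output (?B a) r)} \<le> \<epsilon>" for x
      using bound prob_mem_Domain_le_max_reprogram_prob order_trans by blast
    show "?\<psi> a \<in> ell2"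
      using unit_post_state[OF _ _ a] valid by (simp add: valid_distinguisher_def unit_state_iff)
  qed (rule pos)
  have "(\<integral>\<^sup>+a. w a \<partial>?P) \<le> ennreal q"
    using query_weight_le_expected_queries0[OF valid, of n] by (simp add: w_def q)
  then have "?c * (\<integral>\<^sup>+a. w a \<partial>?P) \<le> ?c * ennreal q"
    by (intro mult_left_mono) simp_all
  also have "\<dots> = ennreal (2 * q * sqrt \<epsilon>)"
    using q pos by (simp add: mult_ac flip: ennreal_mult)
  finally have cost: "?c * (\<integral>\<^sup>+a. w a \<partial>?P) \<le> ennreal (2 * q * sqrt \<epsilon>)" .
  have "(\<integral>\<^sup>+a. I1 a \<partial>?P) \<le> (\<integral>\<^sup>+a. I0 a + ?c * w a \<partial>?P)"
    "(\<integral>\<^sup>+a. I0 a \<partial>?P) \<le> (\<integral>\<^sup>+a. I1 a + ?c * w a \<partial>?P)"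
    using hybrid by (auto intro!: nn_integral_mono_AE simp: AE_measure_pmf_iff)
  then have "(\<integral>\<^sup>+a. I1 a \<partial>?P) \<le> (\<integral>\<^sup>+a. I0 a \<partial>?P) + ennreal (2 * q * sqrt \<epsilon>)"
    "(\<integral>\<^sup>+a. I0 a \<partial>?P) \<le> (\<integral>\<^sup>+a. I1 a \<partial>?P) + ennreal (2 * q * sqrt \<epsilon>)"
    using cost by (auto simp: nn_integral_add nn_integral_cmult elim!: order_trans intro: add_left_mono)
  then show ?thesis
    using q pos
    by (simp add: measure_pmf.emeasure_eq_measure abs_le_iff algebra_simps flip: E0 E1 ennreal_plus)
qed

text \<open>The truncated events increase with \<open>n\<close>, so this is continuity from below;
  runs that never halt lie in none of them.\<close>

lemma tendsto_prob_count_less: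
  "(\<lambda>n. measure_pmf.prob p {x. \<exists>k<n. x = Some (True, k)})
    \<longlonglongrightarrow> measure_pmf.prob p {x. \<exists>k::nat. x = Some (True, k)}"
proof -
  have "(\<lambda>n. measure_pmf.prob p {x. \<exists>k<n. x = Some (True, k)})
      \<longlonglongrightarrow> measure_pmf.prob p (\<Union>n. {x. \<exists>k<n. x = Some (True, k)})"
    by (rule measure_pmf.finite_Lim_measure_incseq) (auto simp: incseq_def intro: less_le_trans)
  moreover have "(\<Union>n. {x. \<exists>k<n. x = Some (True, k)}) = {x. \<exists>k::nat. x = Some (True, k)}"
    by auto
  ultimately show ?thesis by simp
qed

theorem lemma3:
  fixes D :: "('o, 'r, 'm::finite, 'n::finite, 'w) distinguisher"
    and \<epsilon> q :: real
  assumes "valid_distinguisher D"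
    and "\<And>F \<B>. (F, \<B>) \<in> phase1_outputs D \<Longrightarrow> max_reprogram_prob \<B> \<le> \<epsilon>"
    and "0 \<le> q"
    and "expected_queries0 D = ennreal q"
  shows "\<bar>\<P>(\<omega> in measure_pmf (game D). outputs_one \<omega> \<bar> fst \<omega>)
          - \<P>(\<omega> in measure_pmf (game D). outputs_one \<omega> \<bar> \<not> fst \<omega>)\<bar> \<le> 2 * q * sqrt \<epsilon>"
proof -
  let ?A = "{x. \<exists>k. x = Some (True, k :: nat)}"
  let ?d = "\<bar>measure_pmf.prob (branch D True) ?A - measure_pmf.prob (branch D False) ?A\<bar>"
  \<comment> \<open>Some phase 1 output exists, and its reprogramming probabilities force \<epsilon>
    to be nonnegative.\<close>
  obtain a where "a \<in> set_pmf (outcome (meas1 D) (init_state D))"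
    using set_pmf_not_empty by fast
  then have "max_reprogram_prob (snd (phase1_output D a)) \<le> \<epsilon>"
    using assms(2)[of "fst (phase1_output D a)"] by (simp add: phase1_outputs_def)
  with prob_mem_Domain_le_max_reprogram_prob have "\<epsilon> \<ge> 0"
    using measure_nonneg order_trans by metis
  \<comment> \<open>A strictly larger \<epsilon>' is positive, as division by its square root
    requires. Here \<open>n\<close> tends to infinity.\<close>
  have bound: "?d \<le> 2 * q * sqrt \<epsilon>'" if "\<epsilon> < \<epsilon>'" for \<epsilon>'
  proof (rule LIMSEQ_le_const2)
    show "(\<lambda>n. \<bar>measure_pmf.prob (branch D True) {x. \<exists>k<n. x = Some (True, k)} -
        measure_pmf.prob (branch D False) {x. \<exists>k<n. x = Some (True, k)}\<bar>) \<longlonglongrightarrow> ?d"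
      by (intro tendsto_intros tendsto_prob_count_less)
    have "max_reprogram_prob \<B> \<le> \<epsilon>'" if "(F, \<B>) \<in> phase1_outputs D" for F \<B>
      using assms(2)[OF that] \<open>\<epsilon> < \<epsilon>'\<close> by simp
    then show "\<exists>N. \<forall>n\<ge>N. \<bar>measure_pmf.prob (branch D True) {x. \<exists>k<n. x = Some (True, k)} -
        measure_pmf.prob (branch D False) {x. \<exists>k<n. x = Some (True, k)}\<bar> \<le> 2 * q * sqrt \<epsilon>'"
      using branch_accept_diff[OF assms(1) _ _ assms(3,4)] \<open>\<epsilon> \<ge> 0\<close> that by simp
  qed
  \<comment> \<open>Letting \<epsilon>' decrease to \<epsilon> also covers \<epsilon> = 0, by
    continuity of the square root.\<close>
  have "?d \<le> 2 * q * sqrt \<epsilon>"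
  proof (rule tendsto_lowerbound)
    show "((\<lambda>\<epsilon>'. 2 * q * sqrt \<epsilon>') \<longlongrightarrow> 2 * q * sqrt \<epsilon>) (at_right \<epsilon>)"
      by (intro tendsto_intros)
    show "\<forall>\<^sub>F \<epsilon>' in at_right \<epsilon>. ?d \<le> 2 * q * sqrt \<epsilon>'"
      using eventually_at_right_less by (rule eventually_mono) (rule bound)
  qed simp
  then show ?thesis
    by (simp only: prob_outputs_one_True prob_outputs_one_False)
qed

end
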